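(* Let $\mathcal E$ be a nest on a complex Banach space $X$ having the $p_\infty$-property and let $\Psi$ be a support function on $\mathcal E$ with $\Psi(\{0\})=\{0\}$. Then the support function and the essential support function of the $\mathcal T(\mathcal E)$-bimodule $\mathcal M^0(\Psi)$ both equal $\Psi_-$: $\Phi_{\mathcal M^0(\Psi)}=\Psi_-=\Phi^e_{\mathcal M^0(\Psi)}$.
   Context: A nest $\mathcal E$ on $X$ is a family of closed linear subspaces of $X$, totally ordered by inclusion, containing $\{0\}$ and $X$, closed under arbitrary meets $\wedge$ (intersections) and joins $\vee$ (norm-closed linear spans of unions). For $E\in\mathcal E$, $E_-=\vee\{F\in\mathcal E: F\subsetneq E\}$ and $E_+=\wedge\{F\in\mathcal E: E\subsetneq F\}$. For subspaces $M,L$ ($L$ closed), $M/L=\{m+L:m\in M\}$ and $\dim(M/L)$ its dimension. $\mathcal E$ has the $p_\infty$-property if $\dim(N/N_-)=\infty$ for every $N\in\mathcal E$ with $N_-\subsetneq N$ (under this property every support function is an essential support function). A support function is an inclusion-preserving map $\Psi:\mathcal E\to\mathcal E$; $\Psi_-$ is defined by $\Psi_-(\{0\})=\Psi(\{0\})$ and, for $E\neq\{0\}$, $\Psi_-(E)=\Psi(E)$ if $E_-\subsetneq E$, $\Psi_-(E)=\vee_{F\in\mathcal E,F\subsetneq E}\Psi(F)$ if $E_-=E$. $\mathcal T(\mathcal E)=\{T\in\mathcal B(X): TE\subseteq E\ \forall E\}$. $\mathcal M^0(\Psi)$ is the norm closure of $\sum_{L,N\in\mathcal E,\ L_-\subsetneq\Psi(N)}\operatorname{span}\{f\otimes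 x: f\in(N_-)^\perp, x\in L\}$, where $S^\perp=\{f\in X^*:f(S)=\{0\}\}$ and $f\otimes x$ is $y\mapsto f(y)x$. For a bimodule $\mathcal J$, $\Phi_{\mathcal J}(E)=[\mathcal JE]$ (norm-closed linear span of $\{Tx:T\in\mathcal J,x\in E\}$) and $\Phi^e_{\mathcal J}(N)=\wedge\{L\in\mathcal E:\dim(TN/L)<\infty\ \forall T\in\mathcal J\}$. *)

theory Defs
  imports "HOL-Analysis.Analysis"
begin

class complex_banach = banach +
  fixes cscale :: "complex \<Rightarrow> 'a \<Rightarrow> 'a"
  assumes cscale_of_real: "cscale (complex_of_real r) x = r *\<^sub>R x"
    and cscale_add_right: "cscale a (x + y) = cscale a x + cscale a y"
    and cscale_add_left: "cscale (a + b) x = cscale a x + cscale b x"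
    and cscale_cscale: "cscale a (cscale b x) = cscale (a * b) x"
    and norm_cscale: "norm (cscale a x) = cmod a * norm x"

definition csubspace :: "'a::complex_banach set \<Rightarrow> bool" where
  "csubspace M \<longleftrightarrow> subspace M \<and> (\<forall>c x. x \<in> M \<longrightarrow> cscale c x \<in> M)"

definition closed_csubspace :: "'a::complex_banach set \<Rightarrow> bool" where
  "closed_csubspace M \<longleftrightarrow> csubspace M \<and> closed M"

definition cspan :: "'a::complex_banach set \<Rightarrow> 'a set" where
  "cspan S = \<Inter>{M. csubspace M \<and> S \<subseteq> M}"

definition clspan :: "'a::complex_banach set \<Rightarrow> 'a set" where
  "clspan S = closure (cspan S)"

definition is_nest :: "'a::complex_banach set set \<Rightarrow> bool" where
  "is_nest \<E> \<longleftrightarrow> (\<forall>E\<in>\<E>. closed_csubspace E)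
     \<and> (\<forall>A\<in>\<E>. \<forall>B\<in>\<E>. A \<subseteq> B \<or> B \<subseteq> A)
     \<and> {0} \<in> \<E> \<and> UNIV \<in> \<E>
     \<and> (\<forall>S\<subseteq>\<E>. \<Inter>S \<in> \<E>)
     \<and> (\<forall>S\<subseteq>\<E>. clspan (\<Union>S) \<in> \<E>)"

definition nest_pred :: "'a::complex_banach set set \<Rightarrow> 'a set \<Rightarrow> 'a set" where
  "nest_pred \<E> E = clspan (\<Union>{F\<in>\<E>. F \<subset> E})"

definition findim_quot :: "'a::complex_banach set \<Rightarrow> 'a set \<Rightarrow> bool" where
  "findim_quot M L \<longleftrightarrow> (\<exists>F. finite F \<and> M \<subseteq> {u + v | u v. u \<in> cspan F \<and> v \<in> L})"

definition p_infty :: "'a::complex_banach set set \<Rightarrow> bool" where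
  "p_infty \<E> \<longleftrightarrow> (\<forall>N\<in>\<E>. nest_pred \<E> N \<subset> N \<longrightarrow> \<not> findim_quot N (nest_pred \<E> N))"

definition support_function :: "'a::complex_banach set set \<Rightarrow> ('a set \<Rightarrow> 'a set) \<Rightarrow> bool" where
  "support_function \<E> \<Psi> \<longleftrightarrow> (\<forall>E\<in>\<E>. \<Psi> E \<in> \<E>) \<and> (\<forall>E\<in>\<E>. \<forall>F\<in>\<E>. E \<subseteq> F \<longrightarrow> \<Psi> E \<subseteq> \<Psi> F)"

definition psi_minus :: "'a::complex_banach set set \<Rightarrow> ('a set \<Rightarrow> 'a set) \<Rightarrow> 'a set \<Rightarrow> 'a set" where
  "psi_minus \<E> \<Psi> E =
     (if E = {0} then \<Psi> {0}
      else if nest_pred \<E> E \<subset> E then \<Psi> E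
      else clspan (\<Union>{\<Psi> F | F. F \<in> \<E> \<and> F \<subset> E}))"

definition bcl_op :: "('a::complex_banach \<Rightarrow> 'a) \<Rightarrow> bool" where
  "bcl_op T \<longleftrightarrow> bounded_linear T \<and> (\<forall>c x. T (cscale c x) = cscale c (T x))"

definition cfunctional :: "('a::complex_banach \<Rightarrow> complex) \<Rightarrow> bool" where
  "cfunctional f \<longleftrightarrow> bounded_linear f \<and> (\<forall>c x. f (cscale c x) = c * f x)"

definition annihilator :: "'a::complex_banach set \<Rightarrow> ('a \<Rightarrow> complex) set" where
  "annihilator S = {f. cfunctional f \<and> (\<forall>x\<in>S. f x = 0)}"

definition rank_one :: "('a::complex_banach \<Rightarrow> complex) \<Rightarrow> 'a \<Rightarrow> 'a \<Rightarrow> 'a" where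
  "rank_one f x = (\<lambda>y. cscale (f y) x)"

definition nest_alg :: "'a::complex_banach set set \<Rightarrow> ('a \<Rightarrow> 'a) set" where
  "nest_alg \<E> = {T. bcl_op T \<and> (\<forall>E\<in>\<E>. T ` E \<subseteq> E)}"

definition op_span :: "('a::complex_banach \<Rightarrow> 'a) set \<Rightarrow> ('a \<Rightarrow> 'a) set" where
  "op_span G = {(\<lambda>y. \<Sum>i\<in>I. cscale (c i) (g i y)) | (I::nat set) c g. finite I \<and> g ` I \<subseteq> G}"

definition op_closure :: "('a::complex_banach \<Rightarrow> 'a) set \<Rightarrow> ('a \<Rightarrow> 'a) set" where
  "op_closure S = {T. bcl_op T \<and> (\<forall>e>0. \<exists>S'\<in>S. onorm (\<lambda>y. T y - S' y) < e)}"

definition M0 :: "'a::complex_banach set set \<Rightarrow> ('a set \<Rightarrow> 'a set) \<Rightarrow> ('a \<Rightarrow> 'a) set" where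
  "M0 \<E> \<Psi> = op_closure (op_span
     {rank_one f x | f x L N. L \<in> \<E> \<and> N \<in> \<E> \<and> nest_pred \<E> L \<subset> \<Psi> N
        \<and> f \<in> annihilator (nest_pred \<E> N) \<and> x \<in> L})"

definition supp_fun :: "('a::complex_banach \<Rightarrow> 'a) set \<Rightarrow> 'a set \<Rightarrow> 'a set" where
  "supp_fun J E = clspan {T x | T x. T \<in> J \<and> x \<in> E}"

definition ess_supp_fun :: "'a::complex_banach set set \<Rightarrow> ('a \<Rightarrow> 'a) set \<Rightarrow> 'a set \<Rightarrow> 'a set" where
  "ess_supp_fun \<E> J N = \<Inter>{L\<in>\<E>. \<forall>T\<in>J. findim_quot (T ` N) L}"

end

(*
  A generator f (x) x of M^0(Psi) with f in (F_-)^perp and x in L, L_- < Psi(F), kills every N <= F_-,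
  and sends every N with F_- < N into Psi(F) <= Psi_-(N); so Psi_- is an upper bound for both
  support functions.  For the lower bounds it suffices to reach Psi(F) whenever F_- < N.  For the
  support function, Hahn-Banach gives f in (F_-)^perp not vanishing on N, and f (x) x does it.
  For the essential one, suppose L < Psi(F) and choose P with L < P, P_- < Psi(F).
  By the p_infinity property N/F_- and P/L are both infinite dimensional.  A biorthogonal
  sequence f_n in (F_-)^perp, y_n in N and a sequence x_n in P independent modulo L then give
  T = sum c_n f_n (x) x_n in M^0(Psi) with T y_n = c_n x_n, so TN/L is infinite dimensional.
*)
theory Submission
  imports Defs
begin

section \<open>Complex subspaces and closed spans\<close>

lemma cscale_one [simp]: "cscale 1 x = x"
  using cscale_of_real[of 1 x] by simp

text \<open>\<open>complex_banach\<close> puts a complex scaling on top of a real Banach space. This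
  makes the library's algebra of spans and subspaces available over the complex scalars, under the
  prefix \<open>cvs\<close>.\<close>

interpretation cvs: vector_space "cscale :: complex \<Rightarrow> 'a::complex_banach \<Rightarrow> 'a"
  by unfold_locales (auto simp: cscale_add_right cscale_add_left cscale_cscale)

lemma csubspace_iff: "csubspace M \<longleftrightarrow> cvs.subspace M"
proof
  assume "csubspace M" then show "cvs.subspace M"
    unfolding csubspace_def cvs.subspace_def by (auto simp: subspace_def)
next
  assume M: "cvs.subspace M"
  have "r *\<^sub>R x \<in> M" if "x \<in> M" for r x
    using cvs.subspace_scale[OF M that, of "complex_of_real r"] by (simp add: cscale_of_real)
  with M show "csubspace M"
    unfolding csubspace_def cvs.subspace_def by (auto simp: subspace_def)
qed

lemma cspan_eq: "cspan S = cvs.span S"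
  unfolding cspan_def cvs.span_def hull_def csubspace_iff ..

lemma bounded_linear_cscale_right: "bounded_linear (cscale c)"
  by (rule bounded_linear_intro[where K = "cmod c"])
    (auto simp: cscale_add_right norm_cscale cscale_cscale mult.commute simp flip: cscale_of_real)

lemma bounded_linear_cscale_left: "bounded_linear (\<lambda>c. cscale c x)"
  by (rule bounded_linear_intro[where K = "norm x"])
    (auto simp: cscale_add_left norm_cscale cscale_cscale scaleR_conv_of_real simp flip: cscale_of_real)

lemma closed_csubspace_closure:
  assumes "csubspace M" shows "closed_csubspace (closure M)"
proof -
  have "cscale c x \<in> closure M" if "x \<in> closure M" for c x
  proof -
    have "cscale c ` closure M \<subseteq> closure M"
      by (rule image_closure_subset)
        (use assms closure_subset[of M] in \<open>auto simp: csubspace_def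
          intro!: linear_continuous_on bounded_linear_cscale_right\<close>)
    with that show ?thesis by blast
  qed
  moreover have "x + y \<in> closure M" if xy: "x \<in> closure M" "y \<in> closure M" for x y
  proof -
    obtain a b where "\<And>n. a n \<in> M" "a \<longlonglongrightarrow> x" "\<And>n. b n \<in> M" "b \<longlonglongrightarrow> y"
      using xy by (auto simp: closure_sequential)
    then have "\<forall>n. a n + b n \<in> M" "(\<lambda>n. a n + b n) \<longlonglongrightarrow> x + y"
      using assms by (auto simp: csubspace_iff cvs.subspace_add intro: tendsto_add)
    then show ?thesis by (subst closure_sequential) (rule exI conjI)+
  qed
  moreover have "0 \<in> closure M"
    using assms closure_subset[of M] by (auto simp: csubspace_iff cvs.subspace_0)
  ultimately show ?thesis
    unfolding closed_csubspace_def csubspace_iff by (simp add: cvs.subspace_def)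
qed

lemma closed_csubspace_clspan: "closed_csubspace (clspan S)"
  unfolding clspan_def by (rule closed_csubspace_closure) (simp add: csubspace_iff cspan_eq)

lemma clspan_superset: "S \<subseteq> clspan S"
  unfolding clspan_def cspan_eq using cvs.span_superset closure_subset by blast

lemma clspan_minimal:
  assumes "closed_csubspace M" "S \<subseteq> M" shows "clspan S \<subseteq> M"
  using assms unfolding clspan_def closed_csubspace_def csubspace_iff cspan_eq
  by (simp add: closure_minimal cvs.span_minimal)

section \<open>Finite dimension modulo a subspace\<close>

definition csum :: "'a::complex_banach set \<Rightarrow> 'a set \<Rightarrow> 'a set" where
  "csum B L = {u + v | u v. u \<in> cspan B \<and> v \<in> L}"

text \<open>No dimension function on quotients is used: the finite set \<open>B\<close> stays
  explicit, and counting arguments run by induction on it.\<close>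

lemma findim_quot_iff_csum: "findim_quot M L \<longleftrightarrow> (\<exists>B. finite B \<and> M \<subseteq> csum B L)"
  by (simp add: findim_quot_def csum_def)

lemma csum_empty [simp]: "csum {} L = L"
  by (simp add: csum_def cspan_eq)

lemma csubspace_csum:
  assumes "csubspace L" shows "csubspace (csum B L)"
  using assms unfolding csubspace_iff csum_def cspan_eq
  by (intro cvs.subspace_sums cvs.subspace_span)

lemma csum_minimal:
  assumes "csubspace M" "B \<subseteq> M" "L \<subseteq> M" shows "csum B L \<subseteq> M"
  using assms cvs.span_minimal[of B M] unfolding csubspace_iff csum_def cspan_eq
  by (auto intro!: cvs.subspace_add)

lemma csum_superset:
  assumes "csubspace L" shows "B \<subseteq> csum B L" "L \<subseteq> csum B L"
proof -
  have "0 \<in> L" using assms by (simp add: csubspace_iff cvs.subspace_0)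
  then show "B \<subseteq> csum B L"
    unfolding csum_def cspan_eq
    by (force intro: cvs.span_base)
  show "L \<subseteq> csum B L"
    unfolding csum_def cspan_eq
    by (force intro: cvs.span_zero)
qed

lemma csum_mono:
  assumes "csubspace L" "csubspace L'" "B \<subseteq> B'" "L \<subseteq> L'"
  shows "csum B L \<subseteq> csum B' L'"
  using csum_superset[OF assms(2), of B'] assms(3,4)
  by (intro csum_minimal csubspace_csum assms(2)) auto

text \<open>Steinitz exchange modulo \<open>L\<close>. Write \<open>z\<close> as
  \<open>cscale k b\<close> plus a vector of the span of \<open>B\<close> plus a vector of
  \<open>L\<close>. Here \<open>k\<close> cannot vanish, since \<open>z\<close> is outside
  \<open>csum B L\<close>, so \<open>b\<close> can be solved for in terms of \<open>z\<close>, which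
  \<open>M\<close> contains.\<close>

lemma csum_exchange:
  assumes "csubspace L" "csubspace M" "L \<subseteq> M" "z \<in> M" "z \<in> csum (insert b B) L" "z \<notin> csum B L"
  shows "csum (insert b B) L \<subseteq> csum B M"
proof -
  obtain u v where z: "z = u + v" "u \<in> cvs.span (insert b B)" "v \<in> L"
    using assms(5) by (auto simp: csum_def cspan_eq)
  then obtain k where k: "u - cscale k b \<in> cvs.span B"
    by (auto simp: cvs.span_breakdown_eq)
  define w where "w = u - cscale k b"
  have "k \<noteq> 0"
    using assms(6) z k by (auto simp: csum_def cspan_eq)
  moreover have "cscale k b = (z - v) - w"
    using z by (simp add: w_def)
  ultimately have "b = cscale (inverse k) ((z - v) - w)"
    by (metis cscale_cscale cscale_one left_inverse)
  moreover have S: "cvs.subspace (csum B M)"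
    using assms(2) csubspace_csum csubspace_iff by blast
  have "z \<in> csum B M" "v \<in> csum B M"
    using csum_superset[OF assms(2), of B] assms z by auto
  moreover have "w \<in> csum B M"
    using k assms(2) cvs.subspace_0[of M] unfolding w_def csum_def cspan_eq csubspace_iff
    by (intro CollectI exI[of _ "u - cscale k b"] exI[of _ 0]) simp
  ultimately have "b \<in> csum B M"
    using S by (simp add: cvs.subspace_diff cvs.subspace_scale)
  then show ?thesis
    by (intro csum_minimal csubspace_csum) (use assms csum_superset[OF assms(2), of B] in auto)
qed

lemma no_infinite_chain:
  fixes S :: "nat \<Rightarrow> 'a::complex_banach set"
  assumes "finite B" "\<And>n. csubspace (S n)" "\<And>n. S n \<subset> S (Suc n)" "\<And>n. S n \<subseteq> csum B (S 0)"
  shows False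
  using assms
proof (induction B arbitrary: S rule: finite_induct)
  case empty
  from empty.prems(2)[of 0] empty.prems(3)[of 1] show ?case by auto
next
  case (insert b B)
  have mono: "S m \<subseteq> S n" if "m \<le> n" for m n
    using lift_Suc_mono_le[of S m n] insert.prems(2) that by blast
  show ?case
  proof (cases "\<forall>n. S n \<subseteq> csum B (S 0)")
    case True
    then show ?thesis using insert.IH[of S] insert.prems by blast
  next
    case False
    then obtain m z where z: "z \<in> S m" "z \<notin> csum B (S 0)" by blast
    have "csum (insert b B) (S 0) \<subseteq> csum B (S m)"
      by (rule csum_exchange[of _ _ z]) (use insert.prems z mono[of 0 m] in blast)+
    then have "S (m + n) \<subseteq> csum B (S m)" for n
      using insert.prems(3) by blast
    then show ?thesis
      using insert.IH[of "\<lambda>n. S (m + n)"] insert.prems(1,2) by simp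
  qed
qed

section \<open>Hahn-Banach separation from a closed subspace\<close>

text \<open>Only \<open>\<le>\<close> is required in the homogeneity clause; equality then follows by rescaling with \<open>inverse t\<close>.\<close>

definition sublinear :: "('a::real_vector \<Rightarrow> real) \<Rightarrow> bool" where
  "sublinear q \<longleftrightarrow> (\<forall>x y. q (x + y) \<le> q x + q y) \<and> (\<forall>t\<ge>0. \<forall>x. q (t *\<^sub>R x) \<le> t * q x)"

lemma sublinear_add: "sublinear q \<Longrightarrow> q (x + y) \<le> q x + q y"
  and sublinear_scale_le: "sublinear q \<Longrightarrow> 0 \<le> t \<Longrightarrow> q (t *\<^sub>R x) \<le> t * q x"
  by (auto simp: sublinear_def)

lemma sublinear_zero: "sublinear q \<Longrightarrow> q 0 = 0"
  using sublinear_add[of q 0 0] sublinear_scale_le[of q 0 0] by simp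

lemma sublinear_scale:
  assumes "sublinear q" "0 \<le> t" shows "q (t *\<^sub>R x) = t * q x"
proof (cases "t = 0")
  case False
  then have "q x \<le> inverse t * q (t *\<^sub>R x)"
    using sublinear_scale_le[of q "inverse t" "t *\<^sub>R x"] assms by simp
  then have "t * q x \<le> q (t *\<^sub>R x)"
    using False assms(2) by (simp add: field_simps)
  then show ?thesis
    using sublinear_scale_le[OF assms, of x] by simp
qed (simp add: sublinear_zero assms)

lemma sublinear_minus: "sublinear q \<Longrightarrow> - q (- x) \<le> q x"
  using sublinear_add[of q x "- x"] by (simp add: sublinear_zero)

text \<open>Lowers \<open>q\<close> as far as moving in the direction \<open>y\<close> permits. This
  single construction serves twice: it shows that minimal sublinear functionals are additive, and it
  prescribes the value at one vector in the Hahn-Banach theorem.\<close>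

lemma sublinear_tilt:
  assumes q: "sublinear q"
  obtains q' where "sublinear q'" "q' \<le> q" "\<And>x. q' x \<le> q (x + y) - q y"
proof -
  \<comment> \<open>\<open>h\<close> is subadditive and positively homogeneous in the pair of
    \<open>x\<close> and \<open>t\<close>, and this survives the infimum over \<open>t\<close>. The
    parameters 0 and 1 give the two upper bounds on \<open>q'\<close>.\<close>
  define h where "h x t = q (x + t *\<^sub>R y) - t * q y" for x t
  define q' where "q' x = (INF t\<in>{0..}. h x t)" for x
  have "- q (- x) \<le> h x t" if "t \<ge> 0" for x t
    using sublinear_add[OF q, of "x + t *\<^sub>R y" "- x"] sublinear_scale[OF q that, of y]
    by (simp add: h_def)
  then have bdd: "bdd_below (h x ` {0..})" for x
    by (intro bdd_belowI2[where m = "- q (- x)"]) auto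
  have le: "q' x \<le> h x t" if "t \<ge> 0" for x t
    unfolding q'_def using that bdd by (intro cINF_lower) auto
  have ge: "c \<le> q' x" if "\<And>t. t \<ge> 0 \<Longrightarrow> c \<le> h x t" for c x
    unfolding q'_def using that by (intro cINF_greatest) auto
  have "q' (a + b) \<le> q' a + q' b" for a b
  proof -
    have *: "q' (a + b) \<le> h a s + h b t" if "s \<ge> 0" "t \<ge> 0" for s t
      using le[of "s + t" "a + b"] that sublinear_add[OF q, of "a + s *\<^sub>R y" "b + t *\<^sub>R y"]
      by (simp add: h_def algebra_simps)
    have "q' (a + b) - h a s \<le> q' b" if "s \<ge> 0" for s
      by (rule ge) (use *[OF that] in force)
    then have "q' (a + b) - q' b \<le> q' a"
      by (intro ge) force
    then show ?thesis by simp
  qed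
  moreover have "q' (r *\<^sub>R x) \<le> r * q' x" if r: "r \<ge> 0" for r x
  proof (cases "r = 0")
    case True
    then show ?thesis using le[of 0 0] by (simp add: h_def sublinear_zero q)
  next
    case False
    have "inverse r * q' (r *\<^sub>R x) \<le> h x t" if "t \<ge> 0" for t
    proof -
      have "q' (r *\<^sub>R x) \<le> h (r *\<^sub>R x) (r * t)" using le r that by simp
      also have "\<dots> = r * h x t"
        using sublinear_scale[OF q r, of "x + t *\<^sub>R y"] by (simp add: h_def algebra_simps)
      finally show ?thesis using r False by (simp add: field_simps)
    qed
    then have "inverse r * q' (r *\<^sub>R x) \<le> q' x" by (rule ge)
    then show ?thesis using r False by (simp add: field_simps)
  qed
  ultimately have "sublinear q'" by (simp add: sublinear_def)
  moreover have "q' \<le> q" using le[of 0] by (simp add: h_def le_fun_def)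
  moreover have "q' x \<le> q (x + y) - q y" for x using le[of 1 x] by (simp add: h_def)
  ultimately show ?thesis by (rule that)
qed

text \<open>By minimality a tilt of \<open>m\<close> along \<open>y\<close> is \<open>m\<close>
  itself, so the bound on the tilt becomes superadditivity of \<open>m\<close>.\<close>

lemma minimal_sublinear_linear:
  assumes m: "sublinear m" and min: "\<And>q. sublinear q \<Longrightarrow> q \<le> m \<Longrightarrow> q = m"
  shows "linear m"
proof -
  have add: "m (x + y) = m x + m y" for x y
  proof -
    obtain q where "sublinear q" "q \<le> m" "\<And>x. q x \<le> m (x + y) - m y"
      using sublinear_tilt[OF m] by metis
    then have "m x \<le> m (x + y) - m y" using min by metis
    then show ?thesis using sublinear_add[OF m, of x y] by simp
  qed
  have neg: "m (- x) = - m x" for x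
    using add[of x "- x"] sublinear_zero[OF m] by simp
  have "m (t *\<^sub>R x) = t * m x" for t x
    using sublinear_scale[OF m, of t x] sublinear_scale[OF m, of "- t" x] neg[of "t *\<^sub>R x"]
    by (cases "t \<ge> 0") auto
  with add show ?thesis by (intro linearI) auto
qed

text \<open>Zorn's lemma, with the pointwise infimum as lower bound of a chain. The infimum is
  finite because every sublinear functional below \<open>p\<close> is at least
  \<open>- p (- x)\<close> at \<open>x\<close>.\<close>

lemma ex_minimal_sublinear:
  assumes p: "sublinear p"
  obtains m where "sublinear m" "m \<le> p" "\<And>q. sublinear q \<Longrightarrow> q \<le> m \<Longrightarrow> q = m"
proof -
  define A where "A = {q. sublinear q \<and> q \<le> p}"
  \<comment> \<open>The order is reversed, so that a maximal element for \<open>?P\<close> is a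
    minimal functional.\<close>
  let ?P = "\<lambda>a b :: 'a \<Rightarrow> real. b \<le> a"
  have "\<exists>m\<in>A. \<forall>a\<in>A. ?P m a \<longrightarrow> a = m"
  proof (rule predicate_Zorn)
    show "partial_order_on A (relation_of ?P A)"
      by (rule partial_order_on_relation_ofI) auto
    fix C assume C: "C \<in> Chains (relation_of ?P A)"
    show "\<exists>u\<in>A. \<forall>a\<in>C. u \<le> a"
    proof (cases "C = {}")
      case True
      then show ?thesis using p by (auto simp: A_def)
    next
      case False
      have CA: "C \<subseteq> A" and tot: "a \<le> b \<or> b \<le> a" if "a \<in> C" "b \<in> C" for a b
        using C that by (auto simp: Chains_def relation_of_def)
      have CA: "sublinear q" "q \<le> p" if "q \<in> C" for q
        using CA[OF that that] that by (auto simp: A_def)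
      define u where "u x = (INF q\<in>C. q x)" for x
      have "- p (- x) \<le> q x" if "q \<in> C" for q x
        using sublinear_minus[OF CA(1)[OF that], of x] le_funD[OF CA(2)[OF that], of "- x"] by simp
      then have bdd: "bdd_below ((\<lambda>q. q x) ` C)" for x
        by (intro bdd_belowI2[where m = "- p (- x)"]) auto
      have le: "u x \<le> q x" if "q \<in> C" for q x
        unfolding u_def using that bdd by (intro cINF_lower) auto
      have ge: "c \<le> u x" if "\<And>q. q \<in> C \<Longrightarrow> c \<le> q x" for c x
        unfolding u_def using that False by (intro cINF_greatest) auto
      have "u (x + y) \<le> u x + u y" for x y
      proof -
        \<comment> \<open>This is where the chain matters: of two comparable functionals, the
          smaller one bounds \<open>u (x + y)\<close> by the mixed sum.\<close>
        have *: "u (x + y) \<le> q x + r y" if "q \<in> C" "r \<in> C" for q r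
        proof -
          have "u (x + y) \<le> q x + q y" "u (x + y) \<le> r x + r y"
            using le[of _ "x + y"] that sublinear_add[OF CA(1), of _ x y] order_trans by blast+
          moreover have "q y \<le> r y \<or> r x \<le> q x"
            using tot[OF that] by (auto simp: le_fun_def)
          ultimately show ?thesis by linarith
        qed
        have "u (x + y) - q x \<le> u y" if "q \<in> C" for q
          by (rule ge) (use *[OF that] in force)
        then have "u (x + y) - u y \<le> u x"
          by (intro ge) force
        then show ?thesis by simp
      qed
      moreover have "u (t *\<^sub>R x) \<le> t * u x" if t: "t \<ge> 0" for t x
      proof (cases "t = 0")
        case True
        obtain q where "q \<in> C" using False by blast
        then show ?thesis using True le[of q 0] sublinear_zero[OF CA(1), of q] by simp
      next
        case False
        have "inverse t * u (t *\<^sub>R x) \<le> q x" if "q \<in> C" for q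
          using le[OF that, of "t *\<^sub>R x"] sublinear_scale[OF CA(1)[OF that] t, of x] t False
          by (simp add: field_simps)
        then have "inverse t * u (t *\<^sub>R x) \<le> u x" by (rule ge)
        then show ?thesis using t False by (simp add: field_simps)
      qed
      ultimately have "sublinear u" by (simp add: sublinear_def)
      moreover have "u \<le> p"
        using False le CA(2) by (meson ex_in_conv le_funI le_funD order_trans)
      ultimately show ?thesis using le by (auto simp: A_def le_fun_def)
    qed
  qed
  then obtain m where m: "m \<in> A" "\<And>a. a \<in> A \<Longrightarrow> a \<le> m \<Longrightarrow> a = m" by blast
  show ?thesis
  proof (rule that)
    show "sublinear m" "m \<le> p" using m(1) by (auto simp: A_def)
    show "q = m" if "sublinear q" "q \<le> m" for q
      using m that order_trans[of q m p] by (auto simp: A_def)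
  qed
qed

text \<open>Tilting \<open>p\<close> along \<open>y\<close> before minimising pins the value: the
  tilt is at most \<open>- p y\<close> at \<open>- y\<close>, and a linear functional below it is
  therefore at least \<open>p y\<close> at \<open>y\<close>.\<close>

lemma hahn_banach_sublinear:
  fixes p :: "'a::real_vector \<Rightarrow> real"
  assumes p: "sublinear p"
  obtains g where "linear g" "g \<le> p" "g y = p y"
proof -
  obtain q where q: "sublinear q" "q \<le> p" and qy: "\<And>x. q x \<le> p (x + y) - p y"
    using sublinear_tilt[OF p] by metis
  obtain m where m: "sublinear m" "m \<le> q" "\<And>q. sublinear q \<Longrightarrow> q \<le> m \<Longrightarrow> q = m"
    using ex_minimal_sublinear[OF q(1)] by metis
  have lin: "linear m" using minimal_sublinear_linear m by blast
  have "m \<le> p" using m(2) q(2) by order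
  moreover have "m (- y) \<le> - p y"
    using le_funD[OF m(2), of "- y"] qy[of "- y"] sublinear_zero[OF p] by simp
  then have "m y = p y"
    using linear_neg[OF lin, of y] le_funD[OF \<open>m \<le> p\<close>, of y] by simp
  ultimately show ?thesis using lin that by blast
qed

text \<open>The distance to \<open>A\<close> is the dominating functional for the separation below:
  a linear functional under it vanishes on \<open>A\<close> and is bounded by the norm.\<close>

lemma sublinear_infdist:
  fixes A :: "'a::real_normed_vector set"
  assumes A: "subspace A" shows "sublinear (\<lambda>x. infdist x A)"
proof -
  have ne: "A \<noteq> {}" using subspace_0[OF A] by blast
  have ge: "c \<le> infdist x A" if "\<And>a. a \<in> A \<Longrightarrow> c \<le> dist x a" for c x
    unfolding infdist_notempty[OF ne] using that ne by (intro cINF_greatest) auto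
  have "infdist (x + y) A \<le> infdist x A + infdist y A" for x y
  proof -
    have *: "infdist (x + y) A \<le> dist x a + dist y b" if "a \<in> A" "b \<in> A" for a b
      using infdist_le[OF subspace_add[OF A that], of "x + y"] dist_triangle_add[of x y a b] by simp
    have "infdist (x + y) A - dist x a \<le> infdist y A" if "a \<in> A" for a
      by (rule ge) (use *[OF that] in force)
    then have "infdist (x + y) A - infdist y A \<le> infdist x A"
      by (intro ge) force
    then show ?thesis by simp
  qed
  moreover have "infdist (t *\<^sub>R x) A \<le> t * infdist x A" if t: "t \<ge> 0" for t x
  proof (cases "t = 0")
    case True
    then show ?thesis using subspace_0[OF A] by simp
  next
    case False
    have "inverse t * infdist (t *\<^sub>R x) A \<le> dist x a" if "a \<in> A" for a
    proof -
      have "infdist (t *\<^sub>R x) A \<le> t * dist x a"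
        using infdist_le[OF subspace_scale[OF A that, of t], of "t *\<^sub>R x"] t
        by (simp add: dist_norm flip: scaleR_diff_right)
      then show ?thesis using t False by (simp add: field_simps)
    qed
    then have "inverse t * infdist (t *\<^sub>R x) A \<le> infdist x A" by (rule ge)
    then show ?thesis using t False by (simp add: field_simps)
  qed
  ultimately show ?thesis by (simp add: sublinear_def)
qed

text \<open>Hahn-Banach for the distance to \<open>A\<close> gives a real functional
  \<open>g\<close> with \<open>g y\<close> equal to the distance of \<open>y\<close>, which is
  positive as \<open>A\<close> is closed. It is then complexified and divided by its value at
  \<open>y\<close>.\<close>

lemma annihilator_separates:
  assumes A: "closed_csubspace A" and y: "y \<notin> A"
  obtains f where "f \<in> annihilator A" "f y = 1"
proof -
  have sub: "subspace A" and sc: "\<And>c x. x \<in> A \<Longrightarrow> cscale c x \<in> A" and cl: "closed A"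
    using A by (auto simp: closed_csubspace_def csubspace_def)
  have ne: "A \<noteq> {}" using subspace_0[OF sub] by blast
  obtain g where g: "linear g" "g \<le> (\<lambda>x. infdist x A)" "g y = infdist y A"
    using hahn_banach_sublinear[OF sublinear_infdist[OF sub]] by metis
  have gy: "g y \<noteq> 0"
    using infdist_pos_not_in_closed[OF cl ne y] g(3) by simp
  have g0: "g x = 0" if "x \<in> A" for x
    using le_funD[OF g(2), of x] le_funD[OF g(2), of "- x"] that subspace_neg[OF sub that]
      linear_neg[OF g(1), of x] by simp
  have gn: "\<bar>g x\<bar> \<le> norm x" for x
    using le_funD[OF g(2), of x] le_funD[OF g(2), of "- x"] linear_neg[OF g(1), of x]
      infdist_le[OF subspace_0[OF sub], of x] infdist_le[OF subspace_0[OF sub], of "- x"] by simp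
  \<comment> \<open>The usual complexification: the complex-linear functional with real part
    \<open>g\<close>. It vanishes on \<open>A\<close> because \<open>A\<close> is stable under
    multiplication by the imaginary unit.\<close>
  define h where "h x = Complex (g x) (- g (cscale \<i> x))" for x
  have h_add: "h (a + b) = h a + h b" for a b
    by (simp add: h_def cscale_add_right linear_add[OF g(1)] complex_eq_iff)
  have h_scale: "h (cscale c x) = c * h x" for c x
  proof -
    have 1: "cscale c x = Re c *\<^sub>R x + Im c *\<^sub>R cscale \<i> x"
    proof -
      have "cscale c x = cscale (of_real (Re c) + of_real (Im c) * \<i>) x"
        by (rule arg_cong[of _ _ "\<lambda>c. cscale c x"]) (simp add: complex_eq_iff)
      then show ?thesis
        by (simp only: cscale_add_left cscale_of_real flip: cscale_cscale)
    qed
    have 2: "cscale \<i> (cscale c x) = Re c *\<^sub>R cscale \<i> x - Im c *\<^sub>R x"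
    proof -
      have "cscale \<i> (cscale c x) = cscale (of_real (Re c) * \<i> + of_real (- Im c)) x"
        unfolding cscale_cscale by (rule arg_cong[of _ _ "\<lambda>c. cscale c x"]) (simp add: complex_eq_iff)
      then show ?thesis
        by (simp only: cscale_add_left cscale_of_real flip: cscale_cscale) simp
    qed
    show ?thesis
      unfolding h_def 2 unfolding 1
      by (simp add: complex_eq_iff linear_add[OF g(1)] linear_diff[OF g(1)] linear_cmul[OF g(1)])
  qed
  \<comment> \<open>The factor 2 comes from estimating the modulus by the sum of the absolute values
    of the real and imaginary parts.\<close>
  have h_bdd: "cmod (h x) \<le> norm x * 2" for x
    using cmod_le[of "h x"] gn[of x] gn[of "cscale \<i> x"] by (simp add: h_def norm_cscale)
  have "h (r *\<^sub>R x) = r *\<^sub>R h x" for r x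
    using h_scale[of "of_real r" x] by (simp add: cscale_of_real scaleR_conv_of_real)
  then have "bounded_linear h"
    using h_add h_bdd by (intro bounded_linear_intro)
  then have "bounded_linear (\<lambda>x. h x / h y)"
    by (rule bounded_linear_compose[OF bounded_linear_divide])
  then have "(\<lambda>x. h x / h y) \<in> annihilator A"
    by (auto simp: annihilator_def cfunctional_def h_scale) (simp add: h_def g0 sc Complex_eq_0)
  moreover have "h y \<noteq> 0" using gy by (auto simp: h_def complex_eq_iff)
  ultimately show ?thesis using that[of "\<lambda>x. h x / h y"] by simp
qed

section \<open>Independent and biorthogonal sequences\<close>

lemma cfunctional_simps:
  assumes "cfunctional f"
  shows "f 0 = 0" "f (x + y) = f x + f y" "f (x - y) = f x - f y" "f (cscale c x) = c * f x"
    "f (\<Sum>i\<in>I. h i) = (\<Sum>i\<in>I. f (h i))"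
proof -
  have "linear f" using assms by (simp add: cfunctional_def bounded_linear.linear)
  then show "f 0 = 0" "f (x + y) = f x + f y" "f (x - y) = f x - f y"
    "f (\<Sum>i\<in>I. h i) = (\<Sum>i\<in>I. f (h i))"
    by (auto simp: linear_0 linear_add linear_diff linear_sum)
  show "f (cscale c x) = c * f x" using assms by (simp add: cfunctional_def)
qed

lemma annihilator_diff_sum:
  assumes "g \<in> annihilator A" "\<And>i. i \<in> I \<Longrightarrow> f i \<in> annihilator A"
  shows "(\<lambda>x. g x - (\<Sum>i\<in>I. c i * f i x)) \<in> annihilator A"
  using assms unfolding annihilator_def cfunctional_def
  by (auto intro!: bounded_linear_sub bounded_linear_sum bounded_linear_const_mult
      simp: algebra_simps sum_distrib_left)

text \<open>Greedy choice: finitely many vectors never span \<open>M\<close> modulo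
  \<open>L\<close>, so a next vector always exists.\<close>

lemma independent_sequence:
  assumes "\<not> findim_quot M L"
  shows "\<exists>x :: nat \<Rightarrow> 'a::complex_banach. \<forall>n. x n \<in> M \<and> x n \<notin> csum (x ` {..<n}) L"
proof (rule dependent_wellorder_choice)
  \<comment> \<open>The recursion principle asks that the condition at \<open>n\<close> depend only
    on the values chosen before \<open>n\<close>.\<close>
  fix r :: 'a and n :: nat and x x' :: "nat \<Rightarrow> 'a"
  assume "\<And>i. i < n \<Longrightarrow> x i = x' i"
  then have "x ` {..<n} = x' ` {..<n}" by auto
  then show "(r \<in> M \<and> r \<notin> csum (x ` {..<n}) L) = (r \<in> M \<and> r \<notin> csum (x' ` {..<n}) L)"
    by simp
next
  fix n :: nat and x :: "nat \<Rightarrow> 'a"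
  show "\<exists>r. r \<in> M \<and> r \<notin> csum (x ` {..<n}) L"
    using assms by (auto simp: findim_quot_iff_csum)
qed

text \<open>Adjoining the vectors to \<open>L\<close> one at a time gives a strictly increasing
  chain, which \<open>no_infinite_chain\<close> forbids inside \<open>csum B L\<close>.\<close>

lemma independent_escapes_findim:
  fixes x :: "nat \<Rightarrow> 'a::complex_banach"
  assumes L: "csubspace L" and x: "\<And>n. x n \<notin> csum (x ` {..<n}) L" and B: "finite B"
  shows "\<exists>n. x n \<notin> csum B L"
proof (rule ccontr)
  assume "\<not> ?thesis"
  then have xB: "x n \<in> csum B L" for n by blast
  define S where "S n = csum (x ` {..<n}) L" for n
  show False
  proof (rule no_infinite_chain[OF B, of S])
    show "csubspace (S n)" for n by (simp add: S_def csubspace_csum L)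
    have "S n \<subseteq> S (Suc n)" for n
      unfolding S_def by (rule csum_mono[OF L L]) auto
    moreover have "x n \<in> S (Suc n)" for n
      unfolding S_def using csum_superset(1)[OF L, of "x ` {..<Suc n}"] by auto
    moreover have "x n \<notin> S n" for n using x by (simp add: S_def)
    ultimately show "S n \<subset> S (Suc n)" for n by blast
    show "S n \<subseteq> csum B (S 0)" for n
      unfolding S_def using csum_superset(2)[OF L, of B] xB
      by (intro csum_minimal) (auto simp: csubspace_csum L)
  qed
qed

text \<open>Used to isolate single terms of a series of rank-one operators. The pairs are built
  recursively; at each stage the vectors found so far, together with \<open>A\<close>, do not span
  \<open>N\<close>, which leaves room for a new pair.\<close>

lemma biorthogonal_sequence:
  fixes A N :: "'a::complex_banach set"
  assumes A: "closed_csubspace A" and N: "csubspace N" and inf: "\<not> findim_quot N A"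
  shows "\<exists>(f :: nat \<Rightarrow> 'a \<Rightarrow> complex) y. (\<forall>n. f n \<in> annihilator A) \<and> (\<forall>n. y n \<in> N)
    \<and> (\<forall>m n. f m (y n) = (if m = n then 1 else 0))"
proof -
  \<comment> \<open>\<open>P h n r\<close> lets \<open>r\<close> be the pair of index
    \<open>n\<close>. It demands both cross relations with each earlier pair, so any two indices are
    covered from the larger one.\<close>
  define P where "P h n r \<longleftrightarrow> fst r \<in> annihilator A \<and> snd r \<in> N \<and> fst r (snd r) = 1
      \<and> (\<forall>i<n. fst (h i) (snd r) = 0 \<and> fst r (snd (h i)) = 0)"
    for h :: "nat \<Rightarrow> ('a \<Rightarrow> complex) \<times> 'a" and n r
  have bi: "fst (h i) (snd (h j)) = (if i = j then 1 else 0)" if "P h i (h i)" "P h j (h j)" for h i j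
    using that by (cases i j rule: linorder_cases) (auto simp: P_def)
  have "\<exists>h. \<forall>n. P h n (h n)"
  proof (rule dependent_wellorder_choice)
    show "P h n r = P h' n r" if "\<And>i. i < n \<Longrightarrow> h i = h' i" for r h h' n
      using that by (auto simp: P_def)
    fix n h assume IH: "\<And>i. i < n \<Longrightarrow> P h i (h i)"
    define f y where "f i = fst (h i)" and "y i = snd (h i)" for i
    have fA: "f i \<in> annihilator A" and f: "cfunctional (f i)" and yN: "y i \<in> N" if "i < n" for i
      using IH[OF that] by (auto simp: P_def f_def y_def annihilator_def)
    have fy: "f i (y j) = (if i = j then 1 else 0)" if "i < n" "j < n" for i j
      using bi IH that by (simp add: f_def y_def)
    have "\<not> N \<subseteq> csum (y ` {..<n}) A"
      using inf by (simp add: findim_quot_iff_csum)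
    then obtain z where z: "z \<in> N" "z \<notin> csum (y ` {..<n}) A" by blast
    \<comment> \<open>Gram-Schmidt: correct the vector first, then the functional separating it from \<open>A\<close>.\<close>
    define s where "s = (\<Sum>i<n. cscale (f i z) (y i))"
    have "s \<in> cspan (y ` {..<n})"
      unfolding s_def cspan_eq by (intro cvs.span_sum cvs.span_scale cvs.span_base) auto
    then have nA: "z - s \<notin> A"
      using z(2) unfolding csum_def by (auto dest!: spec[of _ s] spec[of _ "z - s"])
    have zN: "z - s \<in> N"
      using N z(1) yN unfolding csubspace_iff s_def
      by (intro cvs.subspace_diff cvs.subspace_sum cvs.subspace_scale) auto
    have fz: "f j (z - s) = 0" if "j < n" for j
    proof -
      have "f j s = (\<Sum>i<n. f i z * (if j = i then 1 else 0))"
        unfolding s_def cfunctional_simps[OF f[OF that]]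
        by (rule sum.cong) (auto simp: fy that)
      also have "\<dots> = f j z" using that by (simp add: sum.delta' if_distrib cong: if_cong)
      finally show ?thesis by (simp add: cfunctional_simps[OF f[OF that]])
    qed
    obtain g where g: "g \<in> annihilator A" "g (z - s) = 1"
      using annihilator_separates[OF A nA] .
    \<comment> \<open>Each \<open>f i\<close> already vanishes at \<open>z - s\<close>, so this
      correction kills the earlier vectors without disturbing the value 1.\<close>
    define g' where "g' x = g x - (\<Sum>i<n. g (y i) * f i x)" for x
    have "g' \<in> annihilator A"
      unfolding g'_def using g fA by (intro annihilator_diff_sum) auto
    moreover have "g' (z - s) = 1"
      using g fz by (simp add: g'_def)
    moreover have "g' (y j) = 0" if "j < n" for j
    proof -
      have "(\<Sum>i<n. g (y i) * f i (y j)) = (\<Sum>i<n. g (y i) * (if i = j then 1 else 0))"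
        by (rule sum.cong) (auto simp: fy that)
      also have "\<dots> = g (y j)" using that by (simp add: sum.delta if_distrib cong: if_cong)
      finally show ?thesis by (simp add: g'_def)
    qed
    ultimately have "P h n (g', z - s)"
      using zN fz by (simp add: P_def f_def y_def)
    then show "\<exists>r. P h n r" ..
  qed
  then obtain h where h: "\<And>n. P h n (h n)" by blast
  have "fst (h n) \<in> annihilator A" "snd (h n) \<in> N" for n using h[of n] by (auto simp: P_def)
  moreover have "fst (h m) (snd (h n)) = (if m = n then 1 else 0)" for m n using bi h by blast
  ultimately show ?thesis
    by (intro exI[of _ "\<lambda>n. fst (h n)"] exI[of _ "\<lambda>n. snd (h n)"] conjI allI)
qed

section \<open>Series of rank-one operators\<close>

lemma bounded_linear_rank_one:
  assumes "cfunctional f" shows "bounded_linear (rank_one f x)"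
  using assms bounded_linear_compose[OF bounded_linear_cscale_left, of f x]
  by (simp add: rank_one_def cfunctional_def)

lemma bcl_op_rank_one:
  assumes "cfunctional f" shows "bcl_op (rank_one f x)"
  using bounded_linear_rank_one[OF assms, of x] cfunctional_simps(4)[OF assms]
  by (simp add: bcl_op_def rank_one_def cscale_cscale)

lemma op_span_superset: "G \<subseteq> op_span G"
proof
  fix T assume "T \<in> G"
  then show "T \<in> op_span G"
    unfolding op_span_def
    by (intro CollectI exI[of _ "{0}"] exI[of _ "\<lambda>_. 1"] exI[of _ "\<lambda>_. T"]) auto
qed

lemma op_span_mono: "G \<subseteq> H \<Longrightarrow> op_span G \<subseteq> op_span H"
  unfolding op_span_def by blast

lemma op_closure_mono: "S \<subseteq> S' \<Longrightarrow> op_closure S \<subseteq> op_closure S'"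
  unfolding op_closure_def by blast

lemma op_closure_superset: "T \<in> S \<Longrightarrow> bcl_op T \<Longrightarrow> T \<in> op_closure S"
  unfolding op_closure_def by (auto intro!: bexI[of _ T] simp: onorm_zero)

lemma bounded_linear_op_span:
  assumes "\<And>g. g \<in> G \<Longrightarrow> bounded_linear g" "T \<in> op_span G"
  shows "bounded_linear T"
  using assms unfolding op_span_def
  by (auto intro!: bounded_linear_sum bounded_linear_compose[OF bounded_linear_cscale_right])

text \<open>Operator-norm approximation of \<open>T\<close> approximates the vector
  \<open>T y\<close>, and a closed subspace keeps the limit. Membership questions about
  \<open>M0\<close> thus reduce to its generators.\<close>

lemma op_closure_span_maps_into:
  assumes G: "\<And>g. g \<in> G \<Longrightarrow> bounded_linear g" "\<And>g. g \<in> G \<Longrightarrow> g y \<in> K"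
    and K: "closed_csubspace K" and T: "T \<in> op_closure (op_span G)"
  shows "T y \<in> K"
proof -
  have sub: "cvs.subspace K" and "closed K"
    using K by (auto simp: closed_csubspace_def csubspace_iff)
  have "\<exists>k\<in>K. dist k (T y) < e" if "e > 0" for e
  proof -
    \<comment> \<open>Adding 1 keeps the denominator positive when \<open>y\<close> is zero.\<close>
    have "e / (norm y + 1) > 0" using that by (simp add: add_nonneg_pos)
    then obtain S where S: "S \<in> op_span G" "onorm (\<lambda>y. T y - S y) < e / (norm y + 1)"
      using T unfolding op_closure_def by blast
    have "S y \<in> K"
      using S(1) G(2) unfolding op_span_def
      by (auto intro!: cvs.subspace_sum[OF sub] cvs.subspace_scale[OF sub])
    moreover have "bounded_linear (\<lambda>y. T y - S y)"
      using T S(1) bounded_linear_op_span[of G S] G(1)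
      by (auto simp: op_closure_def bcl_op_def intro: bounded_linear_sub)
    then have "norm (T y - S y) \<le> onorm (\<lambda>y. T y - S y) * norm y"
      by (rule onorm)
    then have "norm (T y - S y) < e"
    proof -
      assume *: "norm (T y - S y) \<le> onorm (\<lambda>y. T y - S y) * norm y"
      also have "\<dots> \<le> e / (norm y + 1) * norm y"
        using S(2) by (intro mult_right_mono) auto
      also have "\<dots> < e"
        using that by (simp add: add_nonneg_pos divide_less_eq)
      finally show ?thesis .
    qed
    ultimately show ?thesis by (auto simp: dist_norm norm_minus_commute)
  qed
  then show ?thesis using \<open>closed K\<close> by (metis closure_approachable closure_closed)
qed

text \<open>With sufficiently small nonzero coefficients the series converges absolutely in operator
  norm, whatever the sizes of the \<open>f n\<close> and \<open>x n\<close>; its partial sums lie in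
  the span, hence its sum lies in the closure.\<close>

lemma rank_one_series:
  fixes f :: "nat \<Rightarrow> 'a::complex_banach \<Rightarrow> complex" and x :: "nat \<Rightarrow> 'a"
  assumes f: "\<And>n. cfunctional (f n)"
  shows "\<exists>c. \<exists>T \<in> op_closure (op_span (range (\<lambda>n. rank_one (f n) (x n)))).
    (\<forall>n. c n \<noteq> 0) \<and> (\<forall>y. (\<lambda>n. cscale (c n) (rank_one (f n) (x n) y)) sums T y)"
proof -
  define R where "R n = Blinfun (rank_one (f n) (x n))" for n
  have R: "blinfun_apply (R n) = rank_one (f n) (x n)" for n
    by (simp add: R_def bounded_linear_Blinfun_apply bounded_linear_rank_one f)
  \<comment> \<open>Makes the norm of each scaled term at most a power of one half; the summand 1
    covers a term of norm zero.\<close>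
  define r where "r n = inverse ((1 + norm (R n)) * 2 ^ n)" for n
  have r: "r n > 0" for n
    by (auto simp: r_def intro!: mult_pos_pos add_pos_nonneg)
  define U where "U n = r n *\<^sub>R R n" for n
  have "norm (U n) \<le> (1 / 2) ^ n" for n
  proof -
    have "norm (U n) = norm (R n) / (1 + norm (R n)) * (1 / 2) ^ n"
      using r[of n] by (simp add: U_def r_def field_simps)
    also have "\<dots> \<le> 1 * (1 / 2) ^ n"
      by (intro mult_right_mono) (auto simp: divide_le_eq_1 add_pos_nonneg)
    finally show ?thesis by simp
  qed
  then have "summable U"
    by (intro summable_comparison_test'[OF summable_geometric, of "1 / 2 :: real" 0 U]) simp_all
  then have sums: "U sums suminf U" by (rule summable_sums)
  define T where "T = blinfun_apply (suminf U)"
  define c where "c n = complex_of_real (r n)" for n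
  have U: "blinfun_apply (U n) y = cscale (c n) (rank_one (f n) (x n) y)" for n y
    by (simp add: U_def c_def R blinfun.scaleR_left cscale_of_real)
  have Tsums: "(\<lambda>n. cscale (c n) (rank_one (f n) (x n) y)) sums T y" for y
    using bounded_linear.sums[OF blinfun.bounded_linear_left sums, of y] by (simp add: U T_def)
  \<comment> \<open>The space of \<open>blinfun\<close> operators carries only real linearity, so
    complex homogeneity is recovered by comparing the two pointwise series.\<close>
  have "T (cscale a y) = cscale a (T y)" for a y
  proof (rule sums_unique2)
    show "(\<lambda>n. cscale (c n) (rank_one (f n) (x n) (cscale a y))) sums T (cscale a y)"
      by (rule Tsums)
    show "(\<lambda>n. cscale (c n) (rank_one (f n) (x n) (cscale a y))) sums cscale a (T y)"
      using bounded_linear.sums[OF bounded_linear_cscale_right Tsums, of a y]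
      by (simp add: rank_one_def cscale_cscale cfunctional_simps[OF f] mult_ac)
  qed
  then have bcl: "bcl_op T"
    by (simp add: bcl_op_def T_def blinfun.bounded_linear_right)
  have "\<exists>S\<in>op_span (range (\<lambda>n. rank_one (f n) (x n))). onorm (\<lambda>y. T y - S y) < e" if "e > 0" for e
  proof -
    have "(\<lambda>n. \<Sum>i<n. U i) \<longlonglongrightarrow> suminf U"
      using sums by (simp add: sums_def)
    then obtain n where n: "norm ((\<Sum>i<n. U i) - suminf U) < e"
      using \<open>e > 0\<close> LIMSEQ_D by blast
    define S where "S = (\<lambda>y. \<Sum>i<n. cscale (c i) (rank_one (f i) (x i) y))"
    have "S \<in> op_span (range (\<lambda>n. rank_one (f n) (x n)))"
      unfolding op_span_def S_def
      by (intro CollectI exI[of _ "{..<n}"] exI[of _ c] exI[of _ "\<lambda>n. rank_one (f n) (x n)"]) auto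
    moreover have "(\<lambda>y. T y - S y) = blinfun_apply (suminf U - (\<Sum>i<n. U i))"
      by (simp add: fun_eq_iff T_def S_def blinfun.diff_left blinfun.sum_left U)
    then have "onorm (\<lambda>y. T y - S y) < e"
      using n by (simp add: norm_minus_commute flip: norm_blinfun.rep_eq)
    ultimately show ?thesis by blast
  qed
  with bcl have "T \<in> op_closure (op_span (range (\<lambda>n. rank_one (f n) (x n))))"
    by (simp add: op_closure_def)
  moreover have "c n \<noteq> 0" for n using r[of n] by (simp add: c_def)
  ultimately show ?thesis using Tsums by blast
qed

section \<open>Nests\<close>

context
  fixes \<E> :: "'a::complex_banach set set"
  assumes nest: "is_nest \<E>"
begin

lemma nest_closed_csubspace: "E \<in> \<E> \<Longrightarrow> closed_csubspace E"
  and nest_total: "E \<in> \<E> \<Longrightarrow> F \<in> \<E> \<Longrightarrow> E \<subseteq> F \<or> F \<subseteq> E"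
  and nest_clspan: "S \<subseteq> \<E> \<Longrightarrow> clspan (\<Union>S) \<in> \<E>"
  using nest by (auto simp: is_nest_def)

lemma nest_csubspace: "E \<in> \<E> \<Longrightarrow> csubspace E"
  using nest_closed_csubspace by (simp add: closed_csubspace_def)

lemma nest_pred_in: "nest_pred \<E> E \<in> \<E>"
  unfolding nest_pred_def by (rule nest_clspan) auto

lemma nest_pred_upper: "F \<in> \<E> \<Longrightarrow> F \<subset> E \<Longrightarrow> F \<subseteq> nest_pred \<E> E"
  unfolding nest_pred_def using clspan_superset[of "\<Union>{F \<in> \<E>. F \<subset> E}"] by blast

lemma nest_pred_least:
  assumes "K \<in> \<E>" "\<And>F. F \<in> \<E> \<Longrightarrow> F \<subset> E \<Longrightarrow> F \<subseteq> K" shows "nest_pred \<E> E \<subseteq> K"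
  unfolding nest_pred_def
  by (rule clspan_minimal[OF nest_closed_csubspace[OF assms(1)]]) (use assms(2) in blast)

lemma nest_pred_subset: "E \<in> \<E> \<Longrightarrow> nest_pred \<E> E \<subseteq> E"
  by (rule nest_pred_least) auto

text \<open>Without such an \<open>F\<close>, total order would put every member strictly below
  \<open>P\<close> inside \<open>L\<close>, and then the predecessor of \<open>P\<close> as
  well.\<close>

lemma nest_between:
  assumes "L \<in> \<E>" "P \<in> \<E>" "L \<subset> P" "nest_pred \<E> P = P"
  obtains F where "F \<in> \<E>" "L \<subset> F" "F \<subset> P"
proof (rule ccontr)
  assume "\<not> thesis"
  then have "nest_pred \<E> P \<subseteq> L"
    by (intro nest_pred_least assms) (use nest_total[OF assms(1)] that in blast)
  with assms show False by blast
qed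

text \<open>If \<open>P\<close> has a gap below it, \<open>P\<close> itself serves; otherwise any
  member strictly between \<open>L\<close> and \<open>P\<close> does. This finds room for generators
  of \<open>M0\<close> above \<open>L\<close>.\<close>

lemma ex_pred_subset:
  assumes "L \<in> \<E>" "P \<in> \<E>" "L \<subset> P"
  obtains F where "F \<in> \<E>" "L \<subset> F" "nest_pred \<E> F \<subset> P"
proof (cases "nest_pred \<E> P = P")
  case True
  then obtain F where "F \<in> \<E>" "L \<subset> F" "F \<subset> P" using nest_between assms by metis
  then show ?thesis using that[of F] nest_pred_subset[of F] by blast
next
  case False
  then show ?thesis using that[of P] nest_pred_subset[of P] assms by blast
qed

text \<open>Extends the hypothesis on gaps to all pairs of members. A finite-dimensional
  \<open>M\<close> over \<open>A\<close> would be so over its predecessor too, which contains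
  \<open>A\<close>; hence \<open>M\<close> has no gap below it, and infinitely many members climb
  from \<open>A\<close> towards \<open>M\<close>, against \<open>no_infinite_chain\<close>.\<close>

lemma nest_not_findim:
  assumes p: "p_infty \<E>" and A: "A \<in> \<E>" and M: "M \<in> \<E>" and "A \<subset> M"
  shows "\<not> findim_quot M A"
proof
  assume "findim_quot M A"
  then obtain B where B: "finite B" "M \<subseteq> csum B A" by (auto simp: findim_quot_iff_csum)
  have sup: "M \<subseteq> csum B F" if "F \<in> \<E>" "A \<subseteq> F" for F
    using B(2) csum_mono[OF nest_csubspace[OF A] nest_csubspace[OF that(1)] order_refl that(2), of B]
    by blast
  have "A \<subseteq> nest_pred \<E> M" using nest_pred_upper A \<open>A \<subset> M\<close> by blast
  then have "findim_quot M (nest_pred \<E> M)"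
    using B(1) sup[OF nest_pred_in] by (auto simp: findim_quot_iff_csum)
  then have pred: "nest_pred \<E> M = M"
    using p M nest_pred_subset[OF M] by (auto simp: p_infty_def)
  \<comment> \<open>Staying strictly below \<open>M\<close> is part of the invariant, so that
    \<open>nest_between\<close> can be applied again.\<close>
  have "\<exists>S. \<forall>n::nat. (S n \<in> \<E> \<and> A \<subseteq> S n \<and> S n \<subset> M) \<and> S n \<subset> S (Suc n)"
  proof (rule dependent_nat_choice)
    show "\<exists>F. F \<in> \<E> \<and> A \<subseteq> F \<and> F \<subset> M" using A \<open>A \<subset> M\<close> by blast
    fix F :: "'a set" and n :: nat assume F: "F \<in> \<E> \<and> A \<subseteq> F \<and> F \<subset> M"
    then obtain F' where "F' \<in> \<E>" "F \<subset> F'" "F' \<subset> M"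
      using nest_between[of F M] M pred by auto
    with F show "\<exists>F'. (F' \<in> \<E> \<and> A \<subseteq> F' \<and> F' \<subset> M) \<and> F \<subset> F'"
      by (intro exI[of _ F'] conjI) auto
  qed
  then obtain S where S: "\<And>n. S n \<in> \<E>" "\<And>n. A \<subseteq> S n" "\<And>n. S n \<subset> M" "\<And>n. S n \<subset> S (Suc n)"
    by blast
  have "S n \<subseteq> csum B (S 0)" for n using S(3)[of n] sup[OF S(1,2), of 0] by blast
  then show False
    using no_infinite_chain[OF B(1), of S] S(4) nest_csubspace[OF S(1)] by blast
qed

section \<open>Support functions and the bimodule generated by rank-one operators\<close>

context
  fixes \<Psi> :: "'a set \<Rightarrow> 'a set"
  assumes supp: "support_function \<E> \<Psi>"
begin

lemma supp_in: "E \<in> \<E> \<Longrightarrow> \<Psi> E \<in> \<E>"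
  and supp_mono: "E \<in> \<E> \<Longrightarrow> F \<in> \<E> \<Longrightarrow> E \<subseteq> F \<Longrightarrow> \<Psi> E \<subseteq> \<Psi> F"
  using supp by (auto simp: support_function_def)

lemma psi_minus_in: "N \<in> \<E> \<Longrightarrow> psi_minus \<E> \<Psi> N \<in> \<E>"
proof -
  assume "N \<in> \<E>"
  moreover have "{\<Psi> F |F. F \<in> \<E> \<and> F \<subset> N} \<subseteq> \<E>" using supp_in by blast
  then have "clspan (\<Union>{\<Psi> F |F. F \<in> \<E> \<and> F \<subset> N}) \<in> \<E>" by (rule nest_clspan)
  ultimately show ?thesis by (auto simp: psi_minus_def intro: supp_in)
qed

text \<open>Together with \<open>psi_minus_least\<close> this treats both cases of
  \<open>psi_minus\<close> uniformly, as the join of \<open>\<Psi> F\<close> over all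
  \<open>F\<close> whose predecessor is strictly below \<open>N\<close>. Such an \<open>F\<close>
  lies in \<open>N\<close>, and equals \<open>N\<close> only if \<open>N\<close> has a gap below
  it.\<close>

lemma supp_subset_psi_minus:
  assumes F: "F \<in> \<E>" and N: "N \<in> \<E>" and "nest_pred \<E> F \<subset> N"
  shows "\<Psi> F \<subseteq> psi_minus \<E> \<Psi> N"
proof -
  have "0 \<in> nest_pred \<E> F"
    using nest_csubspace[OF nest_pred_in] by (simp add: csubspace_iff cvs.subspace_0)
  with assms(3) have N0: "N \<noteq> {0}" by blast
  have "\<not> N \<subset> F" using nest_pred_upper[of N F] assms by blast
  then have "F \<subseteq> N" using nest_total[OF F N] by blast
  show ?thesis
  proof (cases "nest_pred \<E> N \<subset> N")
    case True
    then show ?thesis using N0 supp_mono[OF F N \<open>F \<subseteq> N\<close>] by (simp add: psi_minus_def)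
  next
    case False
    with assms(3) have "F \<noteq> N" by blast
    then have "F \<subset> N" using \<open>F \<subseteq> N\<close> by blast
    then have "\<Psi> F \<subseteq> \<Union>{\<Psi> F |F. F \<in> \<E> \<and> F \<subset> N}" using F by blast
    also have "\<dots> \<subseteq> clspan \<dots>" by (rule clspan_superset)
    finally show ?thesis using False N0 by (simp add: psi_minus_def)
  qed
qed

text \<open>The family in \<open>le\<close> contains every \<open>F\<close> strictly below
  \<open>N\<close>, and \<open>N\<close> itself if there is a gap. It is empty for \<open>N\<close>
  equal to \<open>{0}\<close>, where the value of \<open>\<Psi>\<close> at \<open>{0}\<close> takes
  over.\<close>

lemma psi_minus_least:
  assumes "\<Psi> {0} = {0}" and K: "closed_csubspace K" and N: "N \<in> \<E>"
    and le: "\<And>F. F \<in> \<E> \<Longrightarrow> nest_pred \<E> F \<subset> N \<Longrightarrow> \<Psi> F \<subseteq> K"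
  shows "psi_minus \<E> \<Psi> N \<subseteq> K"
proof -
  have "0 \<in> K" using K by (simp add: closed_csubspace_def csubspace_iff cvs.subspace_0)
  moreover have "clspan (\<Union>{\<Psi> F |F. F \<in> \<E> \<and> F \<subset> N}) \<subseteq> K"
  proof (rule clspan_minimal[OF K])
    have "\<Psi> F \<subseteq> K" if "F \<in> \<E>" "F \<subset> N" for F
      using le[OF that(1)] nest_pred_subset[OF that(1)] that(2) by blast
    then show "\<Union>{\<Psi> F |F. F \<in> \<E> \<and> F \<subset> N} \<subseteq> K" by blast
  qed
  ultimately show ?thesis
    using le[OF N] assms(1) by (simp add: psi_minus_def)
qed

definition M0_gens :: "('a \<Rightarrow> 'a) set" where
  "M0_gens = {rank_one f x | f x L N. L \<in> \<E> \<and> N \<in> \<E> \<and> nest_pred \<E> L \<subset> \<Psi> N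
        \<and> f \<in> annihilator (nest_pred \<E> N) \<and> x \<in> L}"

lemma M0_eq: "M0 \<E> \<Psi> = op_closure (op_span M0_gens)"
  by (simp add: M0_def M0_gens_def)

lemma M0_maps_into_psi_minus:
  assumes T: "T \<in> M0 \<E> \<Psi>" and N: "N \<in> \<E>" and y: "y \<in> N"
  shows "T y \<in> psi_minus \<E> \<Psi> N"
proof (rule op_closure_span_maps_into[where T = T and y = y and G = M0_gens])
  show "T \<in> op_closure (op_span M0_gens)" using T by (simp add: M0_eq)
  show K: "closed_csubspace (psi_minus \<E> \<Psi> N)"
    by (rule nest_closed_csubspace[OF psi_minus_in[OF N]])
  fix g assume "g \<in> M0_gens"
  then obtain f x L F where g: "g = rank_one f x" and LF: "L \<in> \<E>" "F \<in> \<E>" "nest_pred \<E> L \<subset> \<Psi> F"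
      "f \<in> annihilator (nest_pred \<E> F)" "x \<in> L"
    unfolding M0_gens_def by blast
  show "bounded_linear g"
    using LF by (simp add: g bounded_linear_rank_one annihilator_def)
  show "g y \<in> psi_minus \<E> \<Psi> N"
  proof (cases "N \<subseteq> nest_pred \<E> F")
    case True
    then have "f y = 0" using LF y by (auto simp: annihilator_def)
    then show ?thesis
      using K by (simp add: g rank_one_def closed_csubspace_def csubspace_iff cvs.subspace_0)
  next
    case False
    then have "nest_pred \<E> F \<subset> N" using nest_total[OF N nest_pred_in] by blast
    then have "\<Psi> F \<subseteq> psi_minus \<E> \<Psi> N" using supp_subset_psi_minus N LF by blast
    \<comment> \<open>Were \<open>\<Psi> F\<close> strictly below \<open>L\<close>, it would lie in
      the predecessor of \<open>L\<close>, which is strictly smaller than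
      \<open>\<Psi> F\<close>.\<close>
    moreover have "\<not> \<Psi> F \<subset> L" using nest_pred_upper[of "\<Psi> F" L] supp_in LF by blast
    then have "L \<subseteq> \<Psi> F" using nest_total[of L "\<Psi> F"] supp_in LF by blast
    ultimately have "x \<in> psi_minus \<E> \<Psi> N" using LF by blast
    then show ?thesis
      using K by (simp add: g rank_one_def closed_csubspace_def csubspace_iff cvs.subspace_scale)
  qed
qed

text \<open>A functional with value 1 at some \<open>z\<close> in \<open>N\<close> makes
  \<open>rank_one f x\<close> send \<open>z\<close> to \<open>x\<close>, so every admissible
  \<open>L\<close> is reached.\<close>

lemma supp_subset_supp_fun:
  assumes F: "F \<in> \<E>" and N: "N \<in> \<E>" and "nest_pred \<E> F \<subset> N"
  shows "\<Psi> F \<subseteq> supp_fun (M0 \<E> \<Psi>) N"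
proof -
  let ?K = "supp_fun (M0 \<E> \<Psi>) N"
  have K: "closed_csubspace ?K" by (simp add: supp_fun_def closed_csubspace_clspan)
  obtain z where z: "z \<in> N" "z \<notin> nest_pred \<E> F" using assms(3) by blast
  obtain f where f: "f \<in> annihilator (nest_pred \<E> F)" "f z = 1"
    using annihilator_separates[OF nest_closed_csubspace[OF nest_pred_in] z(2)] .
  have L: "L \<subseteq> ?K" if "L \<in> \<E>" "nest_pred \<E> L \<subset> \<Psi> F" for L
  proof
    fix x assume "x \<in> L"
    then have "rank_one f x \<in> M0_gens" using that f F unfolding M0_gens_def by blast
    then have "rank_one f x \<in> M0 \<E> \<Psi>"
      unfolding M0_eq using f op_span_superset
      by (intro op_closure_superset bcl_op_rank_one) (auto simp: annihilator_def)
    moreover have "x = rank_one f x z" using f by (simp add: rank_one_def)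
    ultimately have "x \<in> {T x |T x. T \<in> M0 \<E> \<Psi> \<and> x \<in> N}" using z by blast
    then show "x \<in> ?K" unfolding supp_fun_def by (rule subsetD[OF clspan_superset])
  qed
  show ?thesis
  \<comment> \<open>With a gap below it, \<open>\<Psi> F\<close> is itself an admissible
    \<open>L\<close>. Without one, it is the closed span of its strictly smaller members, all of
    which are admissible.\<close>
  proof (cases "nest_pred \<E> (\<Psi> F) = \<Psi> F")
    case True
    have "nest_pred \<E> (\<Psi> F) \<subseteq> ?K"
      unfolding nest_pred_def
    proof (rule clspan_minimal[OF K])
      have "E \<subseteq> ?K" if "E \<in> \<E>" "E \<subset> \<Psi> F" for E
        using L[OF that(1)] nest_pred_subset[OF that(1)] that(2) by blast
      then show "\<Union>{E \<in> \<E>. E \<subset> \<Psi> F} \<subseteq> ?K" by blast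
    qed
    with True show ?thesis by simp
  next
    case False
    then show ?thesis using L[of "\<Psi> F"] supp_in[OF F] nest_pred_subset by blast
  qed
qed

lemma supp_subset_of_findim:
  assumes p: "p_infty \<E>" and F: "F \<in> \<E>" and N: "N \<in> \<E>" and "nest_pred \<E> F \<subset> N"
    and L: "L \<in> \<E>" and fin: "\<And>T. T \<in> M0 \<E> \<Psi> \<Longrightarrow> findim_quot (T ` N) L"
  shows "\<Psi> F \<subseteq> L"
proof (rule ccontr)
  assume "\<not> \<Psi> F \<subseteq> L"
  then have "L \<subset> \<Psi> F" using nest_total[OF L supp_in[OF F]] by blast
  \<comment> \<open>The range vectors are taken from \<open>P\<close> because
    \<open>\<Psi> F\<close> itself fails the generator condition when it equals its
    predecessor.\<close>
  then obtain P where P: "P \<in> \<E>" "L \<subset> P" "nest_pred \<E> P \<subset> \<Psi> F"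
    using ex_pred_subset[OF L supp_in[OF F]] by metis
  obtain x :: "nat \<Rightarrow> 'a" where x: "\<And>n. x n \<in> P" "\<And>n. x n \<notin> csum (x ` {..<n}) L"
    using independent_sequence[OF nest_not_findim[OF p L P(1,2)]] by blast
  obtain f :: "nat \<Rightarrow> 'a \<Rightarrow> complex" and y :: "nat \<Rightarrow> 'a"
    where f: "\<And>n. f n \<in> annihilator (nest_pred \<E> F)" and y: "\<And>n. y n \<in> N"
      and fy: "\<And>m n. f m (y n) = (if m = n then 1 else 0)"
    using biorthogonal_sequence[OF nest_closed_csubspace[OF nest_pred_in] nest_csubspace[OF N]
        nest_not_findim[OF p nest_pred_in N assms(4)]] by blast
  have "cfunctional (f n)" for n using f by (simp add: annihilator_def)
  then obtain c T where c: "\<And>n. c n \<noteq> 0"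
      and sums: "\<And>y. (\<lambda>n. cscale (c n) (rank_one (f n) (x n) y)) sums T y"
      and T: "T \<in> op_closure (op_span (range (\<lambda>n. rank_one (f n) (x n))))"
    using rank_one_series[of f x] by blast
  have "range (\<lambda>n. rank_one (f n) (x n)) \<subseteq> M0_gens"
    unfolding M0_gens_def using f x(1) P F by blast
  then have "T \<in> M0 \<E> \<Psi>"
    unfolding M0_eq using T op_closure_mono op_span_mono by blast
  then obtain B where B: "finite B" "T ` N \<subseteq> csum B L"
    using fin by (auto simp: findim_quot_iff_csum)
  \<comment> \<open>Biorthogonality leaves only the term of index \<open>k\<close> in the
    series.\<close>
  have "T (y k) = cscale (c k) (x k)" for k
  proof (rule sums_unique2[OF sums])
    have "(\<lambda>n. if n = k then cscale (c n) (x n) else 0) sums cscale (c k) (x k)"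
      by (rule sums_single)
    moreover have "(\<lambda>n. if n = k then cscale (c n) (x n) else 0)
        = (\<lambda>n. cscale (c n) (rank_one (f n) (x n) (y k)))"
      by (auto simp: rank_one_def fy)
    ultimately show "(\<lambda>n. cscale (c n) (rank_one (f n) (x n) (y k))) sums cscale (c k) (x k)"
      by simp
  qed
  \<comment> \<open>Dividing by the nonzero coefficient puts every \<open>x k\<close> into
    \<open>csum B L\<close>, which an independent sequence cannot satisfy.\<close>
  then have "x k = cscale (inverse (c k)) (T (y k))" for k
    using c[of k] by (simp add: cscale_cscale)
  moreover have "cvs.subspace (csum B L)"
    using csubspace_csum[OF nest_csubspace[OF L]] by (simp add: csubspace_iff)
  ultimately have "x k \<in> csum B L" for k
    using B(2) y by (metis cvs.subspace_scale image_subset_iff)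
  then show False
    using independent_escapes_findim[OF nest_csubspace[OF L] x(2) B(1)] by blast
qed

end

end

theorem mainTheorem18:
  fixes \<E> :: "'a::complex_banach set set" and \<Psi> :: "'a set \<Rightarrow> 'a set"
  assumes "is_nest \<E>" and "p_infty \<E>"
    and "support_function \<E> \<Psi>" and "\<Psi> {0} = {0}"
  shows "\<forall>N\<in>\<E>. supp_fun (M0 \<E> \<Psi>) N = psi_minus \<E> \<Psi> N
                \<and> ess_supp_fun \<E> (M0 \<E> \<Psi>) N = psi_minus \<E> \<Psi> N"
proof (intro ballI conjI)
  fix N assume N: "N \<in> \<E>"
  let ?J = "M0 \<E> \<Psi>" and ?K = "psi_minus \<E> \<Psi> N"
  have K: "?K \<in> \<E>" by (rule psi_minus_in[OF assms(1,3) N])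
  have into: "T x \<in> ?K" if "T \<in> ?J" "x \<in> N" for T x
    using M0_maps_into_psi_minus[OF assms(1,3)] that N by blast
  show "supp_fun ?J N = ?K"
  proof
    show "supp_fun ?J N \<subseteq> ?K"
      unfolding supp_fun_def
      by (rule clspan_minimal[OF nest_closed_csubspace[OF assms(1) K]]) (use into in blast)
    show "?K \<subseteq> supp_fun ?J N"
    proof (rule psi_minus_least[OF assms(1,3,4) _ N])
      show "closed_csubspace (supp_fun ?J N)" by (simp add: supp_fun_def closed_csubspace_clspan)
    qed (rule supp_subset_supp_fun[OF assms(1,3) _ N])
  qed
  show "ess_supp_fun \<E> ?J N = ?K"
  proof
    have "findim_quot (T ` N) ?K" if "T \<in> ?J" for T
      \<comment> \<open>The empty set witnesses a zero quotient, as \<open>T\<close> maps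
        \<open>N\<close> into \<open>?K\<close>; so \<open>?K\<close> is one of the members being
        intersected.\<close>
      using into that by (auto simp: findim_quot_iff_csum intro!: exI[of _ "{}"])
    then show "ess_supp_fun \<E> ?J N \<subseteq> ?K"
      unfolding ess_supp_fun_def using K by blast
    have "?K \<subseteq> L" if "L \<in> \<E>" "\<forall>T\<in>?J. findim_quot (T ` N) L" for L
      using that supp_subset_of_findim[OF assms(1,3,2) _ N]
      by (intro psi_minus_least[OF assms(1,3,4) nest_closed_csubspace[OF assms(1)] N]) auto
    then show "?K \<subseteq> ess_supp_fun \<E> ?J N"
      unfolding ess_supp_fun_def by blast
  qed
qed

end
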